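(* Let $\chi(x)=\bigl(\mu(x)/\widehat\mu(x)\bigr)^{1/2}$ for $x\in\mathcal X$. Then \[ \lVert\widehat{\mathcal Q}-\mathcal G\rVert_\infty\le\lVert\overline{\mathcal G}-\mathcal G\rVert_\infty\bigl(1+\lVert\chi^2-1\rVert_\infty\bigr)+\lVert\chi^2-1\rVert_\infty . \]
   Context: Setting: $\mathcal X$ is a compact subset of a separable Hilbert space, $\mathrm P$ is a Borel probability measure on $\mathcal X$ whose support is a union of several compact connected components, $\beta>0$, and $K(x,y)=\exp(-\beta\|x-y\|^2)$ for $x,y\in\mathcal X$. $\mathcal H$ is the reproducing kernel Hilbert space of $K$, with feature map $\phi_K:\mathcal X\to\mathcal H$, $K(x,y)=\langle\phi_K(x),\phi_K(y)\rangle_{\mathcal H}$. Put $\mu(x)=\int K(x,z)\,\mathrm d\mathrm P(z)$ and $\phi_{\overline K}(x)=\mu(x)^{-1/2}\phi_K(x)$. Let $X_1,\dots,X_n\in\mathcal X$ be an i.i.d. sample drawn according to $\mathrm P$ and $\widehat\mu(x)=\frac1n\sum_{i=1}^nK(x,X_i)$. The operators on $\mathcal H$ are \[ \mathcal G v=\int\langle v,\phi_{\overline K}(z)\rangle_{\mathcal H}\,\phi_{\overline K}(z)\,\mathrm d\mathrm P(z),\qquad \overline{\mathcal G}v=\frac1n\sum_{i=1}^n\langle v,\phi_{\overline K}(X_i)\rangle_{\mathcal H}\,\phi_{\overline K}(X_i), \] \[ \widehat{\mathcal Q}v=\frac1n\sum_{i=1}^n\widehat\mu(X_i)^{-1}\langle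 v,\phi_K(X_i)\rangle_{\mathcal H}\,\phi_K(X_i). \] Norms: $\lVert\cdot\rVert_\infty$ is the operator norm for operators on $\mathcal H$ and the supremum norm over $\mathcal X$ for functions on $\mathcal X$. *)

theory Defs
  imports "HOL-Probability.Probability"
begin

definition topological_support :: "'a::topological_space measure \<Rightarrow> 'a set" where
  "topological_support P =
     {x \<in> space P. \<forall>U. open U \<longrightarrow> x \<in> U \<longrightarrow> emeasure P (U \<inter> space P) > 0}"

definition gaussian_kernel :: "real \<Rightarrow> 'a::real_inner \<Rightarrow> 'a \<Rightarrow> real" where
  "gaussian_kernel \<beta> x y = exp (- \<beta> * (norm (x - y))\<^sup>2)"

text \<open>
  The Hilbert space \<open>'h\<close> is a reproducing kernel Hilbert space of functions on \<open>X\<close>: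
  the linear map \<open>evl\<close> turns a vector into a function, and injectivity says that a vector
  is determined by the values of its function on \<open>X\<close>.
  The sort of \<open>'h\<close> contains separability because the Bochner integral requires it; this
  excludes nothing when \<open>K\<close> is continuous and \<open>X\<close> is separable.
\<close>

definition is_RKHS ::
    "'a set \<Rightarrow> ('a \<Rightarrow> 'a \<Rightarrow> real) \<Rightarrow>
     ('h::{real_inner, banach, second_countable_topology} \<Rightarrow> 'a \<Rightarrow> real) \<Rightarrow> bool" where
  "is_RKHS X K evl \<longleftrightarrow>
     (\<forall>x\<in>X. linear (\<lambda>f. evl f x)) \<and>
     (\<forall>f g. (\<forall>x\<in>X. evl f x = evl g x) \<longrightarrow> f = g) \<and>
     (\<forall>x\<in>X. \<exists>k. (\<forall>y\<in>X. evl k y = K x y) \<and> (\<forall>f. evl f x = f \<bullet> k))"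

definition feature_map ::
    "'a set \<Rightarrow> ('a \<Rightarrow> 'a \<Rightarrow> real) \<Rightarrow> ('a \<Rightarrow> 'h::real_inner) \<Rightarrow> bool" where
  "feature_map X K \<phi> \<longleftrightarrow> (\<forall>x\<in>X. \<forall>y\<in>X. K x y = \<phi> x \<bullet> \<phi> y)"

definition kernel_mean :: "('a \<Rightarrow> 'a \<Rightarrow> real) \<Rightarrow> 'a measure \<Rightarrow> 'a \<Rightarrow> real" where
  "kernel_mean K P x = (\<integral>z. K x z \<partial>P)"

text \<open>A sample of size \<open>n\<close> is the restriction of \<open>s :: nat \<Rightarrow> 'a\<close> to \<open>{1..n}\<close>.\<close>

definition empirical_kernel_mean ::
    "('a \<Rightarrow> 'a \<Rightarrow> real) \<Rightarrow> nat \<Rightarrow> (nat \<Rightarrow> 'a) \<Rightarrow> 'a \<Rightarrow> real" where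
  "empirical_kernel_mean K n s x = (1 / real n) * (\<Sum>i=1..n. K x (s i))"

definition normalized_feature_map ::
    "('a \<Rightarrow> 'a \<Rightarrow> real) \<Rightarrow> 'a measure \<Rightarrow> ('a \<Rightarrow> 'h::real_vector) \<Rightarrow> 'a \<Rightarrow> 'h" where
  "normalized_feature_map K P \<phi> x = (kernel_mean K P x powr (- 1 / 2)) *\<^sub>R \<phi> x"

definition gram_op ::
    "('a \<Rightarrow> 'a \<Rightarrow> real) \<Rightarrow> 'a measure \<Rightarrow>
     ('a \<Rightarrow> 'h::{real_inner, banach, second_countable_topology}) \<Rightarrow> 'h \<Rightarrow> 'h" where
  "gram_op K P \<phi> v =
     (\<integral>z. (v \<bullet> normalized_feature_map K P \<phi> z) *\<^sub>R normalized_feature_map K P \<phi> z \<partial>P)"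

definition empirical_gram_op ::
    "('a \<Rightarrow> 'a \<Rightarrow> real) \<Rightarrow> 'a measure \<Rightarrow> ('a \<Rightarrow> 'h::real_inner) \<Rightarrow>
     nat \<Rightarrow> (nat \<Rightarrow> 'a) \<Rightarrow> 'h \<Rightarrow> 'h" where
  "empirical_gram_op K P \<phi> n s v =
     (1 / real n) *\<^sub>R
       (\<Sum>i=1..n. (v \<bullet> normalized_feature_map K P \<phi> (s i)) *\<^sub>R
                   normalized_feature_map K P \<phi> (s i))"

definition Q_hat ::
    "('a \<Rightarrow> 'a \<Rightarrow> real) \<Rightarrow> ('a \<Rightarrow> 'h::real_inner) \<Rightarrow> nat \<Rightarrow> (nat \<Rightarrow> 'a) \<Rightarrow> 'h \<Rightarrow> 'h" where
  "Q_hat K \<phi> n s v =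
     (1 / real n) *\<^sub>R
       (\<Sum>i=1..n. (inverse (empirical_kernel_mean K n s (s i)) * (v \<bullet> \<phi> (s i))) *\<^sub>R \<phi> (s i))"

definition chi ::
    "('a \<Rightarrow> 'a \<Rightarrow> real) \<Rightarrow> 'a measure \<Rightarrow> nat \<Rightarrow> (nat \<Rightarrow> 'a) \<Rightarrow> 'a \<Rightarrow> real" where
  "chi K P n s x = (kernel_mean K P x / empirical_kernel_mean K n s x) powr (1 / 2)"

text \<open>
  The supremum is taken in \<open>real\<close>, so this is the supremum norm for functions bounded on a
  nonempty \<open>X\<close>.
\<close>

definition sup_norm :: "'a set \<Rightarrow> ('a \<Rightarrow> real) \<Rightarrow> real" where
  "sup_norm X f = (SUP x\<in>X. \<bar>f x\<bar>)"

end

theory Submission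
  imports Defs
begin

text \<open>
  Writing \<open>h = \<langle>v, \<phi>\<rangle> / \<mu>\<close> one has \<open>G v = \<integral> h \<phi> dP\<close>, and since \<open>K \<ge> 0\<close> the bound
  \<open>h x * h y \<le> (h x\<^sup>2 + h y\<^sup>2) / 2\<close> yields
  \<open>\<parallel>G v\<parallel>\<^sup>2 = \<integral>\<integral> h x * h y * K x y \<le> \<integral> h\<^sup>2 \<mu> = \<langle>v, G v\<rangle>\<close>, hence \<open>\<parallel>G\<parallel> \<le> 1\<close>.
  Moreover \<open>Q - G'\<close>, for the empirical operator \<open>G'\<close>, is \<open>G'\<close> with its rank-one summands
  weighted by \<open>\<chi>\<^sup>2 - 1\<close>, so by the Cauchy-Schwarz inequality its norm is at most
  \<open>\<parallel>\<chi>\<^sup>2 - 1\<parallel> \<parallel>G'\<parallel> \<le> \<parallel>\<chi>\<^sup>2 - 1\<parallel> (1 + \<parallel>G' - G\<parallel>)\<close>.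
\<close>

section \<open>Weighted sums of rank-one operators\<close>

text \<open>Pairing the sum \<open>w\<close> with itself and bounding each weight by
  \<open>s\<close> leaves a sum of products, to which Cauchy-Schwarz over the index set applies. The
  hypothesis \<open>bound\<close> then serves twice, for \<open>v\<close> and for \<open>w\<close>.
  The weights may change sign.\<close>

lemma norm_weighted_gram_sum_le:
  fixes u :: "'i \<Rightarrow> 'h::real_inner"
  assumes bound: "\<And>w. (\<Sum>i\<in>I. (w \<bullet> u i)\<^sup>2) \<le> B * (norm w)\<^sup>2"
    and a: "\<And>i. i \<in> I \<Longrightarrow> \<bar>a i\<bar> \<le> s"
    and "0 \<le> s" "0 \<le> B"
  shows "norm (\<Sum>i\<in>I. (a i * (v \<bullet> u i)) *\<^sub>R u i) \<le> s * B * norm v"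
proof -
  define w where "w = (\<Sum>i\<in>I. (a i * (v \<bullet> u i)) *\<^sub>R u i)"
  have "(norm w)\<^sup>2 = w \<bullet> w"
    by (simp add: power2_norm_eq_inner)
  also have "\<dots> = (\<Sum>i\<in>I. a i * (v \<bullet> u i) * (w \<bullet> u i))"
    \<comment> \<open>Only the right-hand factor is unfolded; the other \<open>w\<close> remains as
      the vector paired with each \<open>u i\<close>.\<close>
    by (subst (2) w_def) (simp add: inner_sum_right mult.assoc)
  also have "\<dots> \<le> (\<Sum>i\<in>I. s * (\<bar>v \<bullet> u i\<bar> * \<bar>w \<bullet> u i\<bar>))"
  proof (rule sum_mono)
    fix i assume "i \<in> I"
    have "a i * (v \<bullet> u i) * (w \<bullet> u i) \<le> \<bar>a i\<bar> * (\<bar>v \<bullet> u i\<bar> * \<bar>w \<bullet> u i\<bar>)"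
      by (metis abs_ge_self abs_mult mult.assoc)
    also have "\<dots> \<le> s * (\<bar>v \<bullet> u i\<bar> * \<bar>w \<bullet> u i\<bar>)"
      using a[OF \<open>i \<in> I\<close>] by (intro mult_right_mono) auto
    finally show "a i * (v \<bullet> u i) * (w \<bullet> u i) \<le> s * (\<bar>v \<bullet> u i\<bar> * \<bar>w \<bullet> u i\<bar>)" .
  qed
  also have "\<dots> = s * (\<Sum>i\<in>I. \<bar>v \<bullet> u i\<bar> * \<bar>w \<bullet> u i\<bar>)"
    by (simp add: sum_distrib_left)
  also have "\<dots> \<le> s * (B * norm v * norm w)"
  \<comment> \<open>Squares are compared, since both Cauchy-Schwarz and \<open>bound\<close> speak
    about sums of squares.\<close>
  proof (rule mult_left_mono[OF power2_le_imp_le])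
    have "(\<Sum>i\<in>I. \<bar>v \<bullet> u i\<bar> * \<bar>w \<bullet> u i\<bar>)\<^sup>2
        \<le> (\<Sum>i\<in>I. (v \<bullet> u i)\<^sup>2) * (\<Sum>i\<in>I. (w \<bullet> u i)\<^sup>2)"
      using Cauchy_Schwarz_ineq_sum[of "\<lambda>i. \<bar>v \<bullet> u i\<bar>" "\<lambda>i. \<bar>w \<bullet> u i\<bar>" I] by simp
    also have "\<dots> \<le> (B * (norm v)\<^sup>2) * (B * (norm w)\<^sup>2)"
      using \<open>0 \<le> B\<close> by (intro mult_mono bound) (auto intro: sum_nonneg)
    finally show "(\<Sum>i\<in>I. \<bar>v \<bullet> u i\<bar> * \<bar>w \<bullet> u i\<bar>)\<^sup>2 \<le> (B * norm v * norm w)\<^sup>2"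
      by (simp add: power2_eq_square mult_ac)
  qed (use assms in auto)
  finally have "norm w * norm w \<le> (s * B * norm v) * norm w"
    by (simp add: power2_eq_square mult_ac)
  moreover have "0 \<le> s * B * norm v"
    using assms by simp
  ultimately show ?thesis
    unfolding w_def[symmetric] by (cases "norm w = 0") (auto dest: mult_right_le_imp_le)
qed

section \<open>The integral operator is a contraction\<close>

text \<open>A Schur test for the symmetric nonnegative kernel
  \<open>\<phi> x \<bullet> \<phi> y\<close>: after the mean inequality for
  \<open>h x * h y\<close>, symmetry makes the two halves equal. The bounds \<open>C\<close> and
  \<open>D\<close> provide the integrability for Fubini.\<close>

lemma (in prob_space) norm_integral_scaleR_sq_le:
  fixes \<phi> :: "'a \<Rightarrow> 'h::{real_inner, banach, second_countable_topology}"
  assumes [measurable]: "\<phi> \<in> borel_measurable M" "h \<in> borel_measurable M"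
    and \<phi>: "\<And>x. x \<in> space M \<Longrightarrow> norm (\<phi> x) \<le> C"
    and h: "\<And>x. x \<in> space M \<Longrightarrow> \<bar>h x\<bar> \<le> D"
    and nonneg: "\<And>x y. x \<in> space M \<Longrightarrow> y \<in> space M \<Longrightarrow> 0 \<le> \<phi> x \<bullet> \<phi> y"
  shows "(norm (\<integral>z. h z *\<^sub>R \<phi> z \<partial>M))\<^sup>2 \<le> (\<integral>x. (h x)\<^sup>2 * (\<integral>z. \<phi> x \<bullet> \<phi> z \<partial>M) \<partial>M)"
proof -
  interpret pair: pair_prob_space M M ..
  have C: "0 \<le> C" and D: "0 \<le> D"
    using not_empty \<phi> h norm_ge_zero abs_ge_zero order_trans by blast+
  have int_h\<phi>: "integrable M (\<lambda>z. h z *\<^sub>R \<phi> z)"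
    using \<phi> h D by (intro integrable_const_bound[of _ "D * C"] AE_I2) (auto intro: mult_mono)
  have inner_le: "\<bar>\<phi> x \<bullet> \<phi> y\<bar> \<le> C * C" if "x \<in> space M" "y \<in> space M" for x y
    by (rule order_trans[OF Cauchy_Schwarz_ineq2]) (use that \<phi> C in \<open>auto intro: mult_mono\<close>)
  have sq_le: "\<bar>(h x)\<^sup>2\<bar> \<le> D\<^sup>2" if "x \<in> space M" for x
    using power_mono[OF h[OF that], of 2] by simp
  have int1: "integrable (M \<Otimes>\<^sub>M M) (\<lambda>(x, y). h x * h y * (\<phi> x \<bullet> \<phi> y))"
  proof (intro pair.integrable_const_bound[of _ "D * D * (C * C)"] AE_I2)
    fix p assume "p \<in> space (M \<Otimes>\<^sub>M M)"
    then show "norm (case p of (x, y) \<Rightarrow> h x * h y * (\<phi> x \<bullet> \<phi> y)) \<le> D * D * (C * C)"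
      using inner_le h D by (auto simp: space_pair_measure abs_mult intro!: mult_mono)
  qed measurable
  have int2: "integrable (M \<Otimes>\<^sub>M M) (\<lambda>(x, y). (h x)\<^sup>2 * (\<phi> x \<bullet> \<phi> y))"
  proof (intro pair.integrable_const_bound[of _ "D\<^sup>2 * (C * C)"] AE_I2)
    fix p assume "p \<in> space (M \<Otimes>\<^sub>M M)"
    then show "norm (case p of (x, y) \<Rightarrow> (h x)\<^sup>2 * (\<phi> x \<bullet> \<phi> y)) \<le> D\<^sup>2 * (C * C)"
      using inner_le sq_le D by (auto simp: space_pair_measure abs_mult intro!: mult_mono)
  qed measurable
  \<comment> \<open>This integrand is the previous one with the coordinates swapped.\<close>
  have int3: "integrable (M \<Otimes>\<^sub>M M) (\<lambda>(x, y). (h y)\<^sup>2 * (\<phi> x \<bullet> \<phi> y))"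
    using int2 by (subst (asm) pair.integrable_product_swap_iff[symmetric])
      (simp add: inner_commute case_prod_beta)
  let ?R = "\<integral>x. (h x)\<^sup>2 * (\<integral>z. \<phi> x \<bullet> \<phi> z \<partial>M) \<partial>M"
  have R2: "(\<integral>p. (case p of (x, y) \<Rightarrow> (h x)\<^sup>2 * (\<phi> x \<bullet> \<phi> y)) \<partial>(M \<Otimes>\<^sub>M M)) = ?R"
    using pair.integral_fst'[OF int2] by simp
  \<comment> \<open>Here \<open>x\<close> is integrated out first, whereas \<open>R2\<close>
    integrates out \<open>y\<close> first.\<close>
  have R3: "(\<integral>p. (case p of (x, y) \<Rightarrow> (h y)\<^sup>2 * (\<phi> x \<bullet> \<phi> y)) \<partial>(M \<Otimes>\<^sub>M M)) = ?R"
    using pair.integral_snd[OF int3] by (simp add: inner_commute)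
  define w where "w = (\<integral>z. h z *\<^sub>R \<phi> z \<partial>M)"
  \<comment> \<open>Used with \<open>u = w\<close> and then with \<open>u = \<phi> x\<close>, this
    turns the squared norm into an iterated integral.\<close>
  have inner_w: "(\<integral>z. h z * (u \<bullet> \<phi> z) \<partial>M) = u \<bullet> w" for u
    unfolding w_def by (subst integral_inner_right[symmetric, OF int_h\<phi>]) simp
  have "(norm w)\<^sup>2 = w \<bullet> w"
    by (simp add: power2_norm_eq_inner)
  also have "\<dots> = (\<integral>x. h x * (\<phi> x \<bullet> w) \<partial>M)"
    by (subst inner_w[symmetric]) (simp add: inner_commute)
  also have "\<dots> = (\<integral>x. (\<integral>y. h x * h y * (\<phi> x \<bullet> \<phi> y) \<partial>M) \<partial>M)"
    by (simp add: inner_w[symmetric] mult.assoc)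
  also have "\<dots> = (\<integral>p. (case p of (x, y) \<Rightarrow> h x * h y * (\<phi> x \<bullet> \<phi> y)) \<partial>(M \<Otimes>\<^sub>M M))"
    using pair.integral_fst'[OF int1] by simp
  also have "\<dots> \<le> (\<integral>p. ((case p of (x, y) \<Rightarrow> (h x)\<^sup>2 * (\<phi> x \<bullet> \<phi> y)) +
                      (case p of (x, y) \<Rightarrow> (h y)\<^sup>2 * (\<phi> x \<bullet> \<phi> y))) / 2 \<partial>(M \<Otimes>\<^sub>M M))"
  proof (intro integral_mono int1 int2 int3 integrable_divide Bochner_Integration.integrable_add)
    fix p assume "p \<in> space (M \<Otimes>\<^sub>M M)"
    then obtain x y where p: "p = (x, y)" and xy: "x \<in> space M" "y \<in> space M"
      by (auto simp: space_pair_measure)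
    have "h x * h y \<le> ((h x)\<^sup>2 + (h y)\<^sup>2) / 2"
      using sum_squares_bound[of "h x" "h y"] by simp
    from mult_right_mono[OF this nonneg[OF xy]]
    show "(case p of (x, y) \<Rightarrow> h x * h y * (\<phi> x \<bullet> \<phi> y)) \<le>
        ((case p of (x, y) \<Rightarrow> (h x)\<^sup>2 * (\<phi> x \<bullet> \<phi> y)) +
         (case p of (x, y) \<Rightarrow> (h y)\<^sup>2 * (\<phi> x \<bullet> \<phi> y))) / 2"
      by (simp add: p algebra_simps add_divide_distrib)
  qed
  also have "\<dots> = ?R"
    by (simp add: Bochner_Integration.integral_add[OF int2 int3] R2 R3)
  finally show ?thesis
    by (simp add: w_def)
qed

text \<open>The two inverse square roots combine into one division, which gives the form
  \<open>h z *\<^sub>R \<phi> z\<close> needed for the Schur test.\<close>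

lemma scaleR_normalized_feature_map:
  assumes "0 < kernel_mean K P z"
  shows "(v \<bullet> normalized_feature_map K P \<phi> z) *\<^sub>R normalized_feature_map K P \<phi> z
       = ((v \<bullet> \<phi> z) / kernel_mean K P z) *\<^sub>R \<phi> z"
  using assms by (simp add: normalized_feature_map_def powr_minus powr_half_sqrt divide_simps)

text \<open>The Schur weight is exactly the kernel mean by which the features are normalized, so the
  norm bound has constant 1, whatever \<open>C\<close> and \<open>c\<close> are. Bounded linearity
  is what later makes \<open>onorm\<close> a true bound.\<close>

lemma (in prob_space)
  fixes \<phi> :: "'a \<Rightarrow> 'h::{real_inner, banach, second_countable_topology}"
  assumes [measurable]: "\<phi> \<in> borel_measurable M"
    and \<phi>: "\<And>x. x \<in> space M \<Longrightarrow> norm (\<phi> x) \<le> C"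
    and K: "\<And>x y. x \<in> space M \<Longrightarrow> y \<in> space M \<Longrightarrow> K x y = \<phi> x \<bullet> \<phi> y"
    and nonneg: "\<And>x y. x \<in> space M \<Longrightarrow> y \<in> space M \<Longrightarrow> 0 \<le> K x y"
    and "0 < c" and c: "\<And>x. x \<in> space M \<Longrightarrow> c \<le> kernel_mean K M x"
  shows bounded_linear_gram_op: "bounded_linear (gram_op K M \<phi>)"
    and norm_gram_op_le: "norm (gram_op K M \<phi> v) \<le> norm v"
proof -
  let ?\<mu> = "kernel_mean K M"
  define h where "h v z = (v \<bullet> \<phi> z) / ?\<mu> z" for v z
  have C: "0 \<le> C"
    using not_empty \<phi> norm_ge_zero order_trans by blast
  have \<mu>: "?\<mu> x = (\<integral>z. \<phi> x \<bullet> \<phi> z \<partial>M)" if "x \<in> space M" for x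
    unfolding kernel_mean_def using that by (intro Bochner_Integration.integral_cong) (auto simp: K)
  \<comment> \<open>\<open>K\<close> is tied to \<open>\<phi>\<close> on \<open>space M\<close>
    only, so measurability of \<open>?\<mu>\<close> is transferred from the integral of inner
    products.\<close>
  have "(\<lambda>x. \<integral>z. \<phi> x \<bullet> \<phi> z \<partial>M) \<in> borel_measurable M"
    by measurable
  then have [measurable]: "?\<mu> \<in> borel_measurable M"
    by (subst measurable_cong[OF \<mu>])
  have h_meas [measurable]: "h v \<in> borel_measurable M" for v
    unfolding h_def by measurable
  have h_le: "\<bar>h v x\<bar> \<le> norm v * C / c" if "x \<in> space M" for v x
  proof -
    have "\<bar>v \<bullet> \<phi> x\<bar> \<le> norm v * C"
      by (rule order_trans[OF Cauchy_Schwarz_ineq2]) (use that \<phi> in \<open>auto intro: mult_left_mono\<close>)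
    then show ?thesis
      using c[OF that] \<open>0 < c\<close> C unfolding h_def abs_divide by (intro frac_le) auto
  qed
  have int: "integrable M (\<lambda>z. h v z *\<^sub>R \<phi> z)" for v
    using \<phi> h_le C \<open>0 < c\<close>
    by (intro integrable_const_bound[of _ "(norm v * C / c) * C"] AE_I2)
      (auto simp del: times_divide_eq_left intro!: mult_mono)
  have gram: "gram_op K M \<phi> v = (\<integral>z. h v z *\<^sub>R \<phi> z \<partial>M)" for v
    unfolding gram_op_def h_def
    by (intro Bochner_Integration.integral_cong refl scaleR_normalized_feature_map)
      (use c \<open>0 < c\<close> in \<open>fastforce intro: less_le_trans\<close>)
  have contraction: "norm (gram_op K M \<phi> v) \<le> norm v" for v
  proof -
    have "(norm (gram_op K M \<phi> v))\<^sup>2 \<le> (\<integral>x. (h v x)\<^sup>2 * (\<integral>z. \<phi> x \<bullet> \<phi> z \<partial>M) \<partial>M)"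
      unfolding gram using nonneg K
      by (intro norm_integral_scaleR_sq_le[where C = C and D = "norm v * C / c"] h_le \<phi>) auto
    \<comment> \<open>One of the two denominators in \<open>(h v x)\<^sup>2\<close> cancels against
      the inner integral, which is \<open>?\<mu> x\<close>.\<close>
    also have "\<dots> = (\<integral>x. v \<bullet> (h v x *\<^sub>R \<phi> x) \<partial>M)"
    proof (intro Bochner_Integration.integral_cong refl)
      fix x assume "x \<in> space M"
      then show "(h v x)\<^sup>2 * (\<integral>z. \<phi> x \<bullet> \<phi> z \<partial>M) = v \<bullet> (h v x *\<^sub>R \<phi> x)"
        using c[of x] \<open>0 < c\<close> by (simp add: \<mu>[symmetric] h_def power2_eq_square)
    qed
    also have "\<dots> = v \<bullet> gram_op K M \<phi> v"
      unfolding gram by (rule integral_inner_right[OF int])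
    also have "\<dots> \<le> norm v * norm (gram_op K M \<phi> v)"
      by (rule norm_cauchy_schwarz)
    finally show ?thesis
      by (cases "gram_op K M \<phi> v = 0") (auto simp: power2_eq_square)
  qed
  then show "norm (gram_op K M \<phi> v) \<le> norm v" .
  show "bounded_linear (gram_op K M \<phi>)"
  proof (rule bounded_linear_intro)
    fix v w
    have "h (v + w) z = h v z + h w z" for z
      by (simp add: h_def inner_add_left add_divide_distrib)
    then show "gram_op K M \<phi> (v + w) = gram_op K M \<phi> v + gram_op K M \<phi> w"
      unfolding gram by (simp add: scaleR_add_left Bochner_Integration.integral_add[OF int int])
  next
    fix r v
    have "h (r *\<^sub>R v) z *\<^sub>R \<phi> z = r *\<^sub>R (h v z *\<^sub>R \<phi> z)" for z
      by (simp add: h_def)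
    then show "gram_op K M \<phi> (r *\<^sub>R v) = r *\<^sub>R gram_op K M \<phi> v"
      unfolding gram by (simp del: scaleR_scaleR)
  next
    show "norm (gram_op K M \<phi> v) \<le> norm v * 1" for v
      using contraction by simp
  qed
qed

section \<open>The empirical operator and its quadratic form\<close>

lemma bounded_linear_empirical_gram_op: "bounded_linear (empirical_gram_op K P \<phi> n s)"
  unfolding empirical_gram_op_def
  by (intro bounded_linear_const_scaleR bounded_linear_sum bounded_linear_scaleR_const
      bounded_linear_inner_left)

text \<open>Converts a norm bound for the operator into the sum-of-squares hypothesis of
  \<open>norm_weighted_gram_sum_le\<close>.\<close>

lemma inner_empirical_gram_op:
  "v \<bullet> empirical_gram_op K P \<phi> n s v
     = (\<Sum>i=1..n. (v \<bullet> normalized_feature_map K P \<phi> (s i))\<^sup>2) / real n"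
  by (simp add: empirical_gram_op_def inner_sum_right power2_eq_square)

section \<open>Bounds for the Gaussian kernel and continuity of its feature map\<close>

lemma gaussian_kernel_le_1: "0 \<le> \<beta> \<Longrightarrow> gaussian_kernel \<beta> x y \<le> 1"
  by (simp add: gaussian_kernel_def)

text \<open>The kernel decreases with distance, and distances in \<open>X\<close> are at most the
  diameter. The bound keeps both kernel means away from 0.\<close>

lemma gaussian_kernel_bounded_below:
  assumes "bounded X" "0 \<le> \<beta>"
  shows "\<exists>c>0. \<forall>x\<in>X. \<forall>y\<in>X. c \<le> gaussian_kernel \<beta> x y"
proof (intro exI conjI ballI)
  show "0 < exp (- \<beta> * (diameter X)\<^sup>2)"
    by simp
  fix x y assume "x \<in> X" "y \<in> X"
  with assms have "norm (x - y) \<le> diameter X"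
    using diameter_bounded_bound by (metis dist_norm)
  then show "exp (- \<beta> * (diameter X)\<^sup>2) \<le> gaussian_kernel \<beta> x y"
    using assms by (auto simp: gaussian_kernel_def intro!: mult_left_mono power_mono)
qed

text \<open>The kernel determines distances between features: the squared distance is
  \<open>2 - 2 * gaussian_kernel \<beta> y x\<close>, because the diagonal values are 1. Continuity
  later supplies Borel measurability.\<close>

lemma continuous_on_gaussian_feature_map:
  assumes "feature_map X (gaussian_kernel \<beta>) \<phi>"
  shows "continuous_on X \<phi>"
proof -
  have dist: "norm (\<phi> y - \<phi> x) = sqrt (2 - 2 * gaussian_kernel \<beta> y x)" if "x \<in> X" "y \<in> X" for x y
  proof -
    have "(norm (\<phi> y - \<phi> x))\<^sup>2 = \<phi> y \<bullet> \<phi> y - 2 * (\<phi> y \<bullet> \<phi> x) + \<phi> x \<bullet> \<phi> x"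
      by (simp add: power2_norm_eq_inner inner_diff_left inner_diff_right inner_commute)
    also have "\<dots> = 2 - 2 * gaussian_kernel \<beta> y x"
      using assms that by (simp add: feature_map_def[THEN iffD1, rule_format, symmetric])
        (simp add: gaussian_kernel_def)
    finally show ?thesis
      by (metis norm_ge_zero real_sqrt_unique)
  qed
  show ?thesis
    unfolding continuous_on
  proof
    fix x assume "x \<in> X"
    \<comment> \<open>The limit is first written as the value at \<open>y = x\<close>, the form the
      limit rules produce; it simplifies to 0.\<close>
    have "((\<lambda>y. sqrt (2 - 2 * gaussian_kernel \<beta> y x)) \<longlongrightarrow> sqrt (2 - 2 * exp (- \<beta> * (norm (x - x))\<^sup>2)))
        (at x within X)"
      unfolding gaussian_kernel_def by (intro tendsto_intros)
    then have "((\<lambda>y. sqrt (2 - 2 * gaussian_kernel \<beta> y x)) \<longlongrightarrow> 0) (at x within X)"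
      by simp
    then have "((\<lambda>y. norm (\<phi> y - \<phi> x)) \<longlongrightarrow> 0) (at x within X)"
      by (rule Lim_transform_eventually)
        (use \<open>x \<in> X\<close> in \<open>auto simp: eventually_at_filter dist\<close>)
    then show "(\<phi> \<longlongrightarrow> \<phi> x) (at x within X)"
      using Lim_null tendsto_norm_zero_iff by blast
  qed
qed

section \<open>Comparison of the operators for a fixed sample\<close>

theorem proposition10:
  fixes X :: "'a::{real_inner, banach, second_countable_topology} set"
    and P :: "'a measure"
    and \<beta> :: real
    and K :: "'a \<Rightarrow> 'a \<Rightarrow> real"
    and evl :: "'h::{real_inner, banach, second_countable_topology} \<Rightarrow> 'a \<Rightarrow> real"
    and \<phi> :: "'a \<Rightarrow> 'h"
    and M :: "'w measure"
    and S :: "nat \<Rightarrow> 'w \<Rightarrow> 'a"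
    and n :: nat
    and \<omega> :: 'w
  assumes "compact X"
    and "prob_space P"
    and "sets P = sets (restrict_space borel X)"
    and "finite (components (topological_support P))"
    and "\<forall>C\<in>components (topological_support P). compact C"
    and "\<beta> > 0"
    and "K = gaussian_kernel \<beta>"
    and "is_RKHS X K evl"
    and "feature_map X K \<phi>"
    and "n \<ge> 1"
    and "prob_space M"
    and "prob_space.indep_vars M (\<lambda>_. P) S {1..n}"
    and "\<forall>i\<in>{1..n}. distr M P (S i) = P"
    and "\<omega> \<in> space M"
  shows "onorm (\<lambda>v. Q_hat K \<phi> n (\<lambda>i. S i \<omega>) v - gram_op K P \<phi> v)
       \<le> onorm (\<lambda>v. empirical_gram_op K P \<phi> n (\<lambda>i. S i \<omega>) v - gram_op K P \<phi> v)
            * (1 + sup_norm X (\<lambda>x. (chi K P n (\<lambda>i. S i \<omega>) x)\<^sup>2 - 1))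
          + sup_norm X (\<lambda>x. (chi K P n (\<lambda>i. S i \<omega>) x)\<^sup>2 - 1)"
proof -
  interpret P: prob_space P
    by fact
  let ?s = "\<lambda>i. S i \<omega>"
  let ?\<mu> = "kernel_mean K P" and ?\<mu>' = "empirical_kernel_mean K n ?s"
  let ?G = "gram_op K P \<phi>" and ?G' = "empirical_gram_op K P \<phi> n ?s"
  let ?\<chi> = "chi K P n ?s"
  let ?u = "\<lambda>i. normalized_feature_map K P \<phi> (S i \<omega>)"
  define d where "d = onorm (\<lambda>v. ?G' v - ?G v)"
  define \<sigma> where "\<sigma> = sup_norm X (\<lambda>x. (?\<chi> x)\<^sup>2 - 1)"
  have spaceP: "space P = X"
    using sets_eq_imp_space_eq[OF assms(3)] by (simp add: space_restrict_space)
  have sX: "?s i \<in> X" if "i \<in> {1..n}" for i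
  proof -
    \<comment> \<open>Independence includes measurability, which places every sample value in
      \<open>space P\<close>, that is, in \<open>X\<close>.\<close>
    have "S i \<in> measurable M P"
      using assms(12) that by (simp add: prob_space.indep_vars_def2[OF assms(11)])
    from measurable_space[OF this \<open>\<omega> \<in> space M\<close>] show ?thesis
      by (simp add: spaceP)
  qed
  obtain c where c: "0 < c" "\<And>x y. x \<in> X \<Longrightarrow> y \<in> X \<Longrightarrow> c \<le> K x y"
    using gaussian_kernel_bounded_below[OF compact_imp_bounded[OF assms(1)] less_imp_le[OF assms(6)]]
    unfolding assms(7) by blast
  have K1: "K x y \<le> 1" for x y
    using assms(6,7) by (simp add: gaussian_kernel_le_1)
  have K\<phi>: "K x y = \<phi> x \<bullet> \<phi> y" if "x \<in> X" "y \<in> X" for x y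
    using assms(9) that by (simp add: feature_map_def)
  have K_nonneg: "0 \<le> K x y" if "x \<in> X" "y \<in> X" for x y
    using c that by (meson less_imp_le order_trans)
  have norm_\<phi>: "norm (\<phi> x) \<le> 1" if "x \<in> X" for x
    using K\<phi>[OF that that] K1[of x x] by (simp add: norm_le_square)
  have \<phi>_meas: "\<phi> \<in> borel_measurable P"
    using borel_measurable_continuous_on_restrict[OF continuous_on_gaussian_feature_map] assms(7,9)
      measurable_cong_sets[OF assms(3) refl] by blast
  have int_K: "integrable P (K x)" if "x \<in> X" for x
  proof -
    have "norm (\<phi> x \<bullet> \<phi> y) \<le> 1" if "y \<in> X" for y
      using K1[of x y] K\<phi>[OF \<open>x \<in> X\<close> that] K_nonneg[OF \<open>x \<in> X\<close> that] by simp
    then have "integrable P (\<lambda>y. \<phi> x \<bullet> \<phi> y)"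
      using \<phi>_meas spaceP by (intro P.integrable_const_bound[of _ 1] AE_I2) auto
    then show ?thesis
      using Bochner_Integration.integrable_cong[OF refl, of P "K x" "\<lambda>y. \<phi> x \<bullet> \<phi> y"]
        K\<phi> that spaceP by simp
  qed
  have \<mu>_ge: "c \<le> ?\<mu> x" if "x \<in> X" for x
    unfolding kernel_mean_def using that c spaceP by (intro P.integral_ge_const int_K AE_I2) auto
  have \<mu>_le: "?\<mu> x \<le> 1" if "x \<in> X" for x
    unfolding kernel_mean_def using that K1 by (intro P.integral_le_const int_K AE_I2) auto
  have \<mu>'_ge: "c \<le> ?\<mu>' x" if "x \<in> X" for x
  proof -
    have "real n * c \<le> (\<Sum>i=1..n. K x (?s i))"
      using sum_bounded_below[of "{1..n}" c "\<lambda>i. K x (?s i)"] c(2) that sX by simp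
    then show ?thesis
      using \<open>n \<ge> 1\<close> by (simp add: empirical_kernel_mean_def field_simps)
  qed
  have chi_sq: "(?\<chi> x)\<^sup>2 = ?\<mu> x / ?\<mu>' x" if "x \<in> X" for x
    using \<mu>_ge[OF that] \<mu>'_ge[OF that] c(1) by (simp add: chi_def powr_half_sqrt)
  have \<sigma>: "\<bar>(?\<chi> x)\<^sup>2 - 1\<bar> \<le> \<sigma>" if "x \<in> X" for x
    unfolding \<sigma>_def sup_norm_def
  proof (rule cSUP_upper[OF that])
    \<comment> \<open>A real supremum dominates the values only of a set bounded above. The bound
      \<open>1 / c\<close> comes from \<open>\<mu>_le\<close> and \<open>\<mu>'_ge\<close>; the
      extra 1 pays for the subtraction.\<close>
    show "bdd_above ((\<lambda>x. \<bar>(?\<chi> x)\<^sup>2 - 1\<bar>) ` X)"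
    proof (rule bdd_aboveI2)
      fix x assume x: "x \<in> X"
      then have "0 \<le> (?\<chi> x)\<^sup>2" "(?\<chi> x)\<^sup>2 \<le> 1 / c"
        using \<mu>_ge[OF x] \<mu>_le[OF x] \<mu>'_ge[OF x] c(1) by (auto simp: chi_sq intro!: frac_le)
      then show "\<bar>(?\<chi> x)\<^sup>2 - 1\<bar> \<le> 1 / c + 1"
        by linarith
    qed
  qed
  \<comment> \<open>This needs a point of \<open>X\<close>; as \<open>n \<ge> 1\<close>, the first
    sample value is one.\<close>
  have "0 \<le> \<sigma>"
    using \<sigma>[OF sX[of 1]] \<open>n \<ge> 1\<close> by force
  note gram = \<phi>_meas norm_\<phi> K\<phi> K_nonneg c(1) \<mu>_ge
  have G_lin: "bounded_linear ?G"
    by (rule P.bounded_linear_gram_op[where C = 1 and c = c]) (use gram spaceP in auto)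
  have G_le: "norm (?G v) \<le> norm v" for v
    by (rule P.norm_gram_op_le[where C = 1 and c = c]) (use gram spaceP in auto)
  have diff_lin: "bounded_linear (\<lambda>v. ?G' v - ?G v)"
    by (intro bounded_linear_sub bounded_linear_empirical_gram_op G_lin)
  have "0 \<le> d"
    unfolding d_def by (rule onorm_pos_le[OF diff_lin])
  have d: "norm (?G' v - ?G v) \<le> d * norm v" for v
    unfolding d_def by (rule onorm[OF diff_lin])
  \<comment> \<open>The contraction bound for \<open>?G\<close> gives \<open>1 + d\<close> for
    \<open>?G'\<close>; the factor \<open>real n\<close> undoes the averaging.\<close>
  have G'_le: "(\<Sum>i=1..n. (v \<bullet> ?u i)\<^sup>2) \<le> real n * (1 + d) * (norm v)\<^sup>2" for v
  proof -
    have "norm (?G' v) \<le> (1 + d) * norm v"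
      using norm_triangle_sub[of "?G' v" "?G v"] G_le[of v] d[of v] by (simp add: algebra_simps)
    then have "norm v * norm (?G' v) \<le> norm v * ((1 + d) * norm v)"
      by (rule mult_left_mono) simp
    then have "v \<bullet> ?G' v \<le> (1 + d) * (norm v)\<^sup>2"
      using norm_cauchy_schwarz[of v "?G' v"] by (simp add: power2_eq_square mult_ac)
    then show ?thesis
      using \<open>n \<ge> 1\<close> by (simp add: inner_empirical_gram_op field_simps)
  qed
  \<comment> \<open>Replacing \<open>?\<mu>\<close> by \<open>?\<mu>'\<close> in the denominator
    multiplies each summand of \<open>?G'\<close> by the square of \<open>?\<chi>\<close>.\<close>
  have Q_diff: "Q_hat K \<phi> n ?s v - ?G' v
      = (1 / real n) *\<^sub>R (\<Sum>i=1..n. (((?\<chi> (?s i))\<^sup>2 - 1) * (v \<bullet> ?u i)) *\<^sub>R ?u i)" for v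
  proof -
    have "(inverse (?\<mu>' (?s i)) * (v \<bullet> \<phi> (?s i))) *\<^sub>R \<phi> (?s i) - (v \<bullet> ?u i) *\<^sub>R ?u i
        = (((?\<chi> (?s i))\<^sup>2 - 1) * (v \<bullet> ?u i)) *\<^sub>R ?u i" if "i \<in> {1..n}" for i
    proof -
      have \<mu>_pos: "0 < ?\<mu> (?s i)"
        using \<mu>_ge[OF sX[OF that]] c(1) by linarith
      have "((?\<chi> (?s i))\<^sup>2 * (v \<bullet> ?u i)) *\<^sub>R ?u i
          = (?\<mu> (?s i) / ?\<mu>' (?s i)) *\<^sub>R ((v \<bullet> ?u i) *\<^sub>R ?u i)"
        by (simp add: chi_sq[OF sX[OF that]])
      also have "\<dots> = (inverse (?\<mu>' (?s i)) * (v \<bullet> \<phi> (?s i))) *\<^sub>R \<phi> (?s i)"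
        unfolding scaleR_normalized_feature_map[OF \<mu>_pos] using \<mu>_pos by (simp add: field_simps)
      finally show ?thesis
        by (simp add: algebra_simps)
    qed
    then show ?thesis
      by (simp add: Q_hat_def empirical_gram_op_def scaleR_diff_right[symmetric]
          sum_subtractf[symmetric])
  qed
  have Q_le: "norm (Q_hat K \<phi> n ?s v - ?G' v) \<le> \<sigma> * (1 + d) * norm v" for v
  proof -
    have "norm (\<Sum>i=1..n. (((?\<chi> (?s i))\<^sup>2 - 1) * (v \<bullet> ?u i)) *\<^sub>R ?u i)
        \<le> \<sigma> * (real n * (1 + d)) * norm v"
      by (rule norm_weighted_gram_sum_le)
        (use G'_le \<sigma> sX \<open>0 \<le> \<sigma>\<close> \<open>0 \<le> d\<close> in auto)
    then show ?thesis
      using \<open>n \<ge> 1\<close> by (simp add: Q_diff field_simps)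
  qed
  have "onorm (\<lambda>v. Q_hat K \<phi> n ?s v - ?G v) \<le> d * (1 + \<sigma>) + \<sigma>"
  proof (rule onorm_bound)
    show "0 \<le> d * (1 + \<sigma>) + \<sigma>"
      using \<open>0 \<le> d\<close> \<open>0 \<le> \<sigma>\<close> by simp
    fix v
    have "norm (Q_hat K \<phi> n ?s v - ?G v)
        \<le> norm (Q_hat K \<phi> n ?s v - ?G' v) + norm (?G' v - ?G v)"
      using norm_triangle_ineq[of "Q_hat K \<phi> n ?s v - ?G' v" "?G' v - ?G v"] by simp
    \<comment> \<open>Regrouping \<open>\<sigma> * (1 + d) + d\<close> as
      \<open>d * (1 + \<sigma>) + \<sigma>\<close> gives the claimed form.\<close>
    also have "\<dots> \<le> \<sigma> * (1 + d) * norm v + d * norm v"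
      by (intro add_mono Q_le d)
    finally show "norm (Q_hat K \<phi> n ?s v - ?G v) \<le> (d * (1 + \<sigma>) + \<sigma>) * norm v"
      by (simp add: algebra_simps)
  qed
  then show ?thesis
    by (simp only: d_def \<sigma>_def)
qed

end
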